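(* Let $\mathcal{C}$ be a (strict) symmetric monoidal category, let $(X,\Delta)$ be a comonoid in $\mathcal{C}$, and let $q:X\boxtimes X\to X$ be a morphism such that $(X,q)$ is a binary self-distributive object in $\mathcal{C}$. Then the pair $(X,T)$, where $T=q\circ(q\boxtimes\mathbb{1})$, is a ternary self-distributive object in $\mathcal{C}$. This construction, $(X,q)\mapsto(X,T)$ on objects and the identity on morphisms, defines a functor $\mathcal{F}:\mathcal{BSD}\to\mathcal{TSD}$.
   Context: $\boxtimes$ denotes the tensor product of $\mathcal{C}$, $\tau$ its symmetry, $\mathbb{1}$ identity morphisms. A comonoid in $\mathcal{C}$ is an object $X$ with comultiplication $\Delta:X\to X\boxtimes X$ and counit $\epsilon:X\to I$ satisfying coassociativity and counit axioms. Define $\Delta_1=\mathbb{1}$, $\Delta_2=\Delta$ and inductively $\Delta_n=(\Delta\boxtimes\mathbb{1})\Delta_{n-1}:X\to X^{\boxtimes n}$. The symmetric group $S_N$ acts on $X^{\boxtimes N}$ with the transposition $(i,i+1)$ acting as $\mathbb{1}^{\boxtimes(i-1)}\boxtimes\tau_{X,X}\boxtimes\mathbb{1}^{\boxtimes(N-i-1)}$. Let $\sigma_n$ be the automorphism of $X^{\boxtimes n^2}$ corresponding to the permutation which, viewing the $n^2$ positions $(i-1)n+j$ ($1\le i,j\le n$) as an $n\times n$ array, is transposition of the array, i.e. the product of the transpositions exchanging positions $(i-1)n+j$ and $(j-1)n+i$ for all $i<j$. An $n$-ary self-distributive object in $\mathcal{C}$ is a pair $(X,W)$ where $X$ is a comonoid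 in $\mathcal{C}$ and $W:X^{\boxtimes n}\to X$ is a morphism such that $$W\circ(W\boxtimes\mathbb{1}^{\boxtimes(n-1)})=W\circ W^{\boxtimes n}\circ\sigma_n\circ(\mathbb{1}^{\boxtimes n}\boxtimes\Delta_n^{\boxtimes(n-1)}):X^{\boxtimes(2n-1)}\to X.$$ Binary and ternary mean $n=2$ and $n=3$. The category $n\mathcal{SD}$ has as objects the $n$-ary self-distributive objects of $\mathcal{C}$, and as morphisms $(X,W)\to(X',W')$ the morphisms $f:X\to X'$ in $\mathcal{C}$ with $f\circ W=W'\circ f^{\boxtimes n}$. $\mathcal{BSD}=2\mathcal{SD}$ and $\mathcal{TSD}=3\mathcal{SD}$. *)

theory Defs
  imports "HOL-Algebra.Sym_Groups"
begin

section \<open>Categories and functors\<close>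

record ('o, 'a) category =
  Obj :: "'o set"
  Arr :: "'a set"
  Dom :: "'a \<Rightarrow> 'o"
  Cod :: "'a \<Rightarrow> 'o"
  Ident :: "'o \<Rightarrow> 'a"
  Comp :: "'a \<Rightarrow> 'a \<Rightarrow> 'a" (infixr \<open>\<cdot>\<index>\<close> 55)

definition Hom :: "('o, 'a, 'm) category_scheme \<Rightarrow> 'o \<Rightarrow> 'o \<Rightarrow> 'a set" where
  "Hom C X Y = {f \<in> Arr C. Dom C f = X \<and> Cod C f = Y}"

locale category =
  fixes C :: "('o, 'a, 'm) category_scheme" (structure)
  assumes Dom_closed: "f \<in> Arr C \<Longrightarrow> Dom C f \<in> Obj C"
    and Cod_closed: "f \<in> Arr C \<Longrightarrow> Cod C f \<in> Obj C"
    and Ident_closed: "X \<in> Obj C \<Longrightarrow> Ident C X \<in> Hom C X X"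
    and Comp_closed: "\<lbrakk>f \<in> Hom C X Y; g \<in> Hom C Y Z\<rbrakk> \<Longrightarrow> g \<cdot> f \<in> Hom C X Z"
    and Comp_Ident: "f \<in> Hom C X Y \<Longrightarrow> f \<cdot> Ident C X = f"
    and Ident_Comp: "f \<in> Hom C X Y \<Longrightarrow> Ident C Y \<cdot> f = f"
    and Comp_assoc: "\<lbrakk>f \<in> Hom C X Y; g \<in> Hom C Y Z; h \<in> Hom C Z V\<rbrakk>
          \<Longrightarrow> (h \<cdot> g) \<cdot> f = h \<cdot> (g \<cdot> f)"

locale category_functor = A: category A + B: category B
  for A :: "('o, 'a, 'm) category_scheme" and B :: "('p, 'b, 'n) category_scheme" +
  fixes F_obj :: "'o \<Rightarrow> 'p" and F_arr :: "'a \<Rightarrow> 'b"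
  assumes F_obj_closed: "X \<in> Obj A \<Longrightarrow> F_obj X \<in> Obj B"
    and F_arr_closed: "f \<in> Hom A X Y \<Longrightarrow> F_arr f \<in> Hom B (F_obj X) (F_obj Y)"
    and F_Ident: "X \<in> Obj A \<Longrightarrow> F_arr (Ident A X) = Ident B (F_obj X)"
    and F_Comp: "\<lbrakk>f \<in> Hom A X Y; g \<in> Hom A Y Z\<rbrakk>
          \<Longrightarrow> F_arr (Comp A g f) = Comp B (F_arr g) (F_arr f)"

definition aut_group :: "('o, 'a, 'm) category_scheme \<Rightarrow> 'o \<Rightarrow> 'a monoid" where
  "aut_group C Y =
     \<lparr> carrier = {f \<in> Hom C Y Y. \<exists>g \<in> Hom C Y Y. Comp C g f = Ident C Y \<and> Comp C f g = Ident C Y},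
       mult = Comp C, one = Ident C Y \<rparr>"


section \<open>Strict symmetric monoidal categories\<close>

record ('o, 'a) monoidal_category = "('o, 'a) category" +
  Unit :: 'o
  TensorO :: "'o \<Rightarrow> 'o \<Rightarrow> 'o" (infixr \<open>\<boxtimes>\<^sub>o\<index>\<close> 65)
  Tensor :: "'a \<Rightarrow> 'a \<Rightarrow> 'a" (infixr \<open>\<boxtimes>\<index>\<close> 65)
  Symm :: "'o \<Rightarrow> 'o \<Rightarrow> 'a"

text \<open>The remaining unit coherence, that the symmetry at \<open>(X, I)\<close> is the identity, follows
  from the hexagon and invertibility.\<close>

locale strict_symmetric_monoidal_category = category C
  for C :: "('o, 'a, 'm) monoidal_category_scheme" (structure) +
  assumes Unit_closed: "Unit C \<in> Obj C"
    and TensorO_closed: "\<lbrakk>X \<in> Obj C; Y \<in> Obj C\<rbrakk> \<Longrightarrow> X \<boxtimes>\<^sub>o Y \<in> Obj C"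
    and Tensor_closed: "\<lbrakk>f \<in> Hom C X X'; g \<in> Hom C Y Y'\<rbrakk>
          \<Longrightarrow> f \<boxtimes> g \<in> Hom C (X \<boxtimes>\<^sub>o Y) (X' \<boxtimes>\<^sub>o Y')"
    and Tensor_Ident: "\<lbrakk>X \<in> Obj C; Y \<in> Obj C\<rbrakk>
          \<Longrightarrow> Ident C X \<boxtimes> Ident C Y = Ident C (X \<boxtimes>\<^sub>o Y)"
    and Tensor_Comp: "\<lbrakk>f \<in> Hom C X Y; f' \<in> Hom C Y Z; g \<in> Hom C X' Y'; g' \<in> Hom C Y' Z'\<rbrakk>
          \<Longrightarrow> (f' \<cdot> f) \<boxtimes> (g' \<cdot> g) = (f' \<boxtimes> g') \<cdot> (f \<boxtimes> g)"
    and TensorO_assoc: "\<lbrakk>X \<in> Obj C; Y \<in> Obj C; Z \<in> Obj C\<rbrakk>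
          \<Longrightarrow> (X \<boxtimes>\<^sub>o Y) \<boxtimes>\<^sub>o Z = X \<boxtimes>\<^sub>o (Y \<boxtimes>\<^sub>o Z)"
    and TensorO_Unit: "X \<in> Obj C \<Longrightarrow> X \<boxtimes>\<^sub>o Unit C = X"
    and Unit_TensorO: "X \<in> Obj C \<Longrightarrow> Unit C \<boxtimes>\<^sub>o X = X"
    and Tensor_assoc: "\<lbrakk>f \<in> Arr C; g \<in> Arr C; h \<in> Arr C\<rbrakk>
          \<Longrightarrow> (f \<boxtimes> g) \<boxtimes> h = f \<boxtimes> (g \<boxtimes> h)"
    and Tensor_Unit: "f \<in> Arr C \<Longrightarrow> f \<boxtimes> Ident C (Unit C) = f"
    and Unit_Tensor: "f \<in> Arr C \<Longrightarrow> Ident C (Unit C) \<boxtimes> f = f"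
    and Symm_closed: "\<lbrakk>X \<in> Obj C; Y \<in> Obj C\<rbrakk> \<Longrightarrow> Symm C X Y \<in> Hom C (X \<boxtimes>\<^sub>o Y) (Y \<boxtimes>\<^sub>o X)"
    and Symm_natural: "\<lbrakk>f \<in> Hom C X X'; g \<in> Hom C Y Y'\<rbrakk>
          \<Longrightarrow> Symm C X' Y' \<cdot> (f \<boxtimes> g) = (g \<boxtimes> f) \<cdot> Symm C X Y"
    and Symm_involutive: "\<lbrakk>X \<in> Obj C; Y \<in> Obj C\<rbrakk>
          \<Longrightarrow> Symm C Y X \<cdot> Symm C X Y = Ident C (X \<boxtimes>\<^sub>o Y)"
    and Symm_hexagon: "\<lbrakk>X \<in> Obj C; Y \<in> Obj C; Z \<in> Obj C\<rbrakk>
          \<Longrightarrow> Symm C X (Y \<boxtimes>\<^sub>o Z)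
              = (Ident C Y \<boxtimes> Symm C X Z) \<cdot> (Symm C X Y \<boxtimes> Ident C Z)"

primrec obj_power :: "('o, 'a, 'm) monoidal_category_scheme \<Rightarrow> 'o \<Rightarrow> nat \<Rightarrow> 'o" where
  "obj_power C X 0 = Unit C"
| "obj_power C X (Suc n) = TensorO C (obj_power C X n) X"

primrec arr_power :: "('o, 'a, 'm) monoidal_category_scheme \<Rightarrow> 'a \<Rightarrow> nat \<Rightarrow> 'a" where
  "arr_power C f 0 = Ident C (Unit C)"
| "arr_power C f (Suc n) = Tensor C (arr_power C f n) f"


section \<open>The action of the symmetric group on tensor powers\<close>

definition adjacent_swap ::
    "('o, 'a, 'm) monoidal_category_scheme \<Rightarrow> 'o \<Rightarrow> nat \<Rightarrow> nat \<Rightarrow> 'a" where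
  "adjacent_swap C X N i =
     Tensor C (arr_power C (Ident C X) (i - 1))
       (Tensor C (Symm C X X) (arr_power C (Ident C X) (N - i - 1)))"

definition symmetric_action ::
    "('o, 'a, 'm) monoidal_category_scheme \<Rightarrow> 'o \<Rightarrow> nat \<Rightarrow> ((nat \<Rightarrow> nat) \<Rightarrow> 'a) \<Rightarrow> bool" where
  "symmetric_action C X N \<rho> \<longleftrightarrow>
     \<rho> \<in> hom (sym_group N) (aut_group C (obj_power C X N)) \<and>
     (\<forall>i \<in> {1..<N}. \<rho> (transpose i (i + 1)) = adjacent_swap C X N i)"

text \<open>By coherence, an action as above exists, and it is unique on \<open>sym_group N\<close> because the
  adjacent transpositions generate this group; only its value at \<open>p\<close> is selected, since a function
  \<open>\<rho>\<close> is unconstrained outside the carrier.\<close>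

definition perm_arr ::
    "('o, 'a, 'm) monoidal_category_scheme \<Rightarrow> 'o \<Rightarrow> nat \<Rightarrow> (nat \<Rightarrow> nat) \<Rightarrow> 'a" where
  "perm_arr C X N p = (THE f. \<exists>\<rho>. symmetric_action C X N \<rho> \<and> f = \<rho> p)"

definition array_transpose :: "nat \<Rightarrow> nat \<Rightarrow> nat" where
  "array_transpose n k =
     (if k \<in> {1..n\<^sup>2} then ((k - 1) mod n) * n + (k - 1) div n + 1 else k)"

lemma array_transpose_position:
  assumes "i \<in> {1..n}" and "j \<in> {1..n}"
  shows "array_transpose n ((i - 1) * n + j) = (j - 1) * n + i"
proof -
  obtain i' j' where ij: "i = Suc i'" "j = Suc j'" and lt: "i' < n" "j' < n"
    using assms by (cases i; cases j) auto
  have "Suc i' * n \<le> n * n"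
    using lt by (intro mult_le_mono1) simp
  then have "i' * n + j \<le> n\<^sup>2"
    using lt ij by (simp add: power2_eq_square)
  then show ?thesis
    using ij lt by (simp add: array_transpose_def)
qed

definition sigma :: "('o, 'a, 'm) monoidal_category_scheme \<Rightarrow> 'o \<Rightarrow> nat \<Rightarrow> 'a" where
  "sigma C X n = perm_arr C X (n\<^sup>2) (array_transpose n)"


section \<open>Comonoids and self-distributive objects\<close>

record ('o, 'a) comonoid =
  object :: 'o
  comult :: 'a
  counit :: 'a

locale comonoid = strict_symmetric_monoidal_category C
  for C :: "('o, 'a, 'm) monoidal_category_scheme" (structure) +
  fixes X :: "('o, 'a) comonoid"
  assumes object_closed: "object X \<in> Obj C"
    and comult_closed: "comult X \<in> Hom C (object X) (object X \<boxtimes>\<^sub>o object X)"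
    and counit_closed: "counit X \<in> Hom C (object X) (Unit C)"
    and coassociative: "(comult X \<boxtimes> Ident C (object X)) \<cdot> comult X
          = (Ident C (object X) \<boxtimes> comult X) \<cdot> comult X"
    and left_counit: "(counit X \<boxtimes> Ident C (object X)) \<cdot> comult X = Ident C (object X)"
    and right_counit: "(Ident C (object X) \<boxtimes> counit X) \<cdot> comult X = Ident C (object X)"

text \<open>The iterated comultiplication is only needed for \<open>n \<ge> 1\<close>; at \<open>0\<close> we put the counit.\<close>

fun iterated_comult ::
    "('o, 'a, 'm) monoidal_category_scheme \<Rightarrow> ('o, 'a) comonoid \<Rightarrow> nat \<Rightarrow> 'a" where
  "iterated_comult C X 0 = counit X"
| "iterated_comult C X (Suc 0) = Ident C (object X)"
| "iterated_comult C X (Suc (Suc 0)) = comult X"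
| "iterated_comult C X (Suc (Suc (Suc n))) =
     Comp C (Tensor C (comult X) (arr_power C (Ident C (object X)) (Suc n)))
       (iterated_comult C X (Suc (Suc n)))"

definition self_distributive ::
    "('o, 'a, 'm) monoidal_category_scheme \<Rightarrow> nat \<Rightarrow> ('o, 'a) comonoid \<times> 'a \<Rightarrow> bool" where
  "self_distributive C n = (\<lambda>(X, W).
     n \<ge> 1 \<and> comonoid C X \<and> W \<in> Hom C (obj_power C (object X) n) (object X) \<and>
     Comp C W (Tensor C W (arr_power C (Ident C (object X)) (n - 1))) =
     Comp C W (Comp C (arr_power C W n) (Comp C (sigma C (object X) n)
       (Tensor C (arr_power C (Ident C (object X)) n)
         (arr_power C (iterated_comult C X n) (n - 1))))))"

text \<open>A morphism carries its source and target, as the same arrow of \<open>C\<close> may be a morphism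
  between several pairs of self-distributive objects. It need not respect the comonoid structures.\<close>

definition SD :: "('o, 'a, 'm) monoidal_category_scheme \<Rightarrow> nat \<Rightarrow>
    (('o, 'a) comonoid \<times> 'a,
     (('o, 'a) comonoid \<times> 'a) \<times> 'a \<times> (('o, 'a) comonoid \<times> 'a)) category" where
  "SD C n =
     \<lparr> Obj = {P. self_distributive C n P},
       Arr = {((X, W), f, (X', W')) | X W f X' W'.
                self_distributive C n (X, W) \<and> self_distributive C n (X', W') \<and>
                f \<in> Hom C (object X) (object X') \<and>
                Comp C f W = Comp C W' (arr_power C f n)},
       Dom = (\<lambda>(P, f, Q). P),
       Cod = (\<lambda>(P, f, Q). Q),
       Ident = (\<lambda>(X, W). ((X, W), Ident C (object X), (X, W))),
       Comp = (\<lambda>(P', g, Q') (P, f, Q). (P, Comp C g f, Q')) \<rparr>"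

abbreviation BSD where "BSD C \<equiv> SD C 2"

abbreviation TSD where "TSD C \<equiv> SD C 3"

definition ternary_obj :: "('o, 'a, 'm) monoidal_category_scheme \<Rightarrow>
    ('o, 'a) comonoid \<times> 'a \<Rightarrow> ('o, 'a) comonoid \<times> 'a" where
  "ternary_obj C = (\<lambda>(X, q). (X, Comp C q (Tensor C q (Ident C (object X)))))"

definition ternary_arr :: "('o, 'a, 'm) monoidal_category_scheme \<Rightarrow>
    (('o, 'a) comonoid \<times> 'a) \<times> 'a \<times> (('o, 'a) comonoid \<times> 'a) \<Rightarrow>
    (('o, 'a) comonoid \<times> 'a) \<times> 'a \<times> (('o, 'a) comonoid \<times> 'a)" where
  "ternary_arr C = (\<lambda>(P, f, Q). (ternary_obj C P, f, ternary_obj C Q))"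

end

theory Submission
  imports Defs
begin

text \<open>Write \<open>q(x, y)\<close> as \<open>xy\<close>. Distributivity says that right multiplication by \<open>u\<close> can be moved inside
  a product once \<open>u\<close> has been comultiplied, so \<open>T(x, y, z)u = T(xu\<^sub>1, yu\<^sub>2, zu\<^sub>3)\<close>. Multiplying by
  \<open>u\<close> and then by \<open>v\<close> gives ternary distributivity. Only the raw inputs \<open>u\<close> and \<open>v\<close> are ever
  comultiplied, so \<open>q\<close> need not respect the comonoid structure.

  What remains is to identify the permutations of tensor factors that occur. The action of \<open>S\<^sub>N\<close> is
  obtained from the Coxeter presentation: the adjacent swaps satisfy the Coxeter relations, and by
  these every word in \<open>s\<^sub>1, \<dots>, s\<^sub>n\<close> equals \<open>s\<^sub>k \<dots> s\<^sub>n v\<close> with \<open>v\<close> a word in the first \<open>n - 1\<close> letters.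
  Here \<open>k\<close> is the image of \<open>n + 1\<close> under the permutation, so by induction two words with the same
  permutation have the same value.\<close>

section \<open>Families satisfying the Coxeter relations\<close>

declare upt_Suc [simp del] sym_group_one [simp] sym_group_mult [simp]

definition word_prod :: "('g, 'm) monoid_scheme \<Rightarrow> (nat \<Rightarrow> 'g) \<Rightarrow> nat list \<Rightarrow> 'g" where
  "word_prod G s w = foldr (\<lambda>i. mult G (s i)) w (one G)"

lemma word_prod_Nil [simp]: "word_prod G s [] = \<one>\<^bsub>G\<^esub>"
  by (simp add: word_prod_def)

lemma word_prod_Cons [simp]: "word_prod G s (i # w) = s i \<otimes>\<^bsub>G\<^esub> word_prod G s w"
  by (simp add: word_prod_def)

lemma word_prod_cong:
  "(\<And>i. i \<in> set w \<Longrightarrow> s i = t i) \<Longrightarrow> word_prod G s w = word_prod G t w"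
  by (induction w) auto

lemma hom_word_prod:
  assumes "\<rho> \<in> hom G H" "group G" "group H" "\<And>i. i \<in> set w \<Longrightarrow> t i \<in> carrier G"
  shows "\<rho> (word_prod G t w) = word_prod H (\<lambda>i. \<rho> (t i)) w"
proof -
  interpret G: group G by fact
  \<comment> \<open>Membership in the carrier is carried along because \<open>hom_mult\<close>
    applies only to carrier elements.\<close>
  have "word_prod G t w \<in> carrier G \<and> \<rho> (word_prod G t w) = word_prod H (\<lambda>i. \<rho> (t i)) w"
    using assms(4) by (induction w) (auto simp: hom_one[OF assms(1-3)] hom_mult[OF assms(1)])
  then show ?thesis ..
qed

text \<open>The Coxeter relations of \<open>sym_group N\<close>, imposed in a monoid:
  \<open>square\<close> already makes every letter invertible. The locale is used twice, for
  adjacent transpositions and for adjacent swaps of tensor factors.\<close>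

locale coxeter_family = monoid G for G (structure) +
  fixes s :: "nat \<Rightarrow> 'a" and N :: nat
  assumes closed: "i \<in> {1..<N} \<Longrightarrow> s i \<in> carrier G"
    and square: "i \<in> {1..<N} \<Longrightarrow> s i \<otimes> s i = \<one>"
    and braid: "\<lbrakk>1 \<le> i; Suc i < N\<rbrakk> \<Longrightarrow> s i \<otimes> (s (Suc i) \<otimes> s i) = s (Suc i) \<otimes> (s i \<otimes> s (Suc i))"
    and commute: "\<lbrakk>1 \<le> i; Suc i < j; j < N\<rbrakk> \<Longrightarrow> s i \<otimes> s j = s j \<otimes> s i"
begin

abbreviation prod where "prod \<equiv> word_prod G s"

lemma prod_closed: "set w \<subseteq> {1..<N} \<Longrightarrow> prod w \<in> carrier G"
  by (induction w) (auto simp: closed)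

lemma prod_append:
  "\<lbrakk>set v \<subseteq> {1..<N}; set w \<subseteq> {1..<N}\<rbrakk> \<Longrightarrow> prod (v @ w) = prod v \<otimes> prod w"
  by (induction v) (auto simp: closed prod_closed m_assoc)

lemma prod_rev: "set w \<subseteq> {1..<N} \<Longrightarrow> prod w \<otimes> prod (rev w) = \<one>"
proof (induction w)
  case (Cons i w)
  have c: "s i \<in> carrier G" "prod w \<in> carrier G" "prod (rev w) \<in> carrier G"
    using Cons.prems by (auto simp: closed prod_closed)
  have "prod (i # w) \<otimes> prod (rev (i # w)) = s i \<otimes> (prod w \<otimes> (prod (rev w) \<otimes> s i))"
    using Cons.prems c by (simp add: prod_append m_assoc)
  also have "\<dots> = s i \<otimes> ((prod w \<otimes> prod (rev w)) \<otimes> s i)"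
    using c by (simp add: m_assoc)
  also have "\<dots> = \<one>"
    using Cons c by (simp add: square)
  finally show ?case .
qed simp

lemma commute_word:
  assumes "i \<in> {1..<N}" "set w \<subseteq> {1..<N}" "\<And>j. j \<in> set w \<Longrightarrow> Suc i < j \<or> Suc j < i"
  shows "s i \<otimes> prod w = prod w \<otimes> s i"
  using assms(2,3)
proof (induction w)
  case (Cons j w)
  have c: "s i \<in> carrier G" "s j \<in> carrier G" "prod w \<in> carrier G"
    using Cons.prems assms(1) by (auto simp: closed prod_closed)
  have sw: "s i \<otimes> s j = s j \<otimes> s i"
    using Cons.prems assms(1) commute[of i j] commute[of j i] by fastforce
  have "s i \<otimes> prod (j # w) = (s i \<otimes> s j) \<otimes> prod w"
    using c by (simp add: m_assoc)
  also have "\<dots> = s j \<otimes> (s i \<otimes> prod w)"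
    using c by (simp add: sw m_assoc)
  also have "\<dots> = prod (j # w) \<otimes> s i"
    using Cons c by (simp add: m_assoc)
  finally show ?case .
qed (use assms in \<open>auto simp: closed\<close>)

text \<open>Conjugation by the cycle word shifts indices by one: \<open>s i\<close> commutes with
  the letters below \<open>i - 1\<close>, one braid move turns it into \<open>s (i - 1)\<close>, and
  this commutes with the letters above \<open>i\<close>.\<close>

lemma slide:
  assumes "1 \<le> k" "k < i" "i \<le> n" "n < N"
  shows "s i \<otimes> prod [k..<Suc n] = prod [k..<Suc n] \<otimes> s (i - 1)"
proof -
  obtain j where i: "i = Suc j" using assms by (cases i) auto
  \<comment> \<open>The cut isolates the two letters on which the braid relation acts.\<close>
  have split: "[k..<Suc n] = [k..<j] @ j # Suc j # [Suc (Suc j)..<Suc n]"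
    using assms i upt_add_eq_append[of k j "Suc n - j"]
    by (simp add: upt_conv_Cons)
  let ?A = "prod [k..<j]" and ?B = "prod [Suc (Suc j)..<Suc n]"
  have c: "?A \<in> carrier G" "?B \<in> carrier G" "s j \<in> carrier G" "s (Suc j) \<in> carrier G"
    using assms i by (auto intro!: closed prod_closed)
  have P: "prod [k..<Suc n] = ?A \<otimes> (s j \<otimes> (s (Suc j) \<otimes> ?B))"
    unfolding split using assms i by (subst prod_append) auto
  have A: "s (Suc j) \<otimes> ?A = ?A \<otimes> s (Suc j)"
    using assms i by (intro commute_word) auto
  have B: "s j \<otimes> ?B = ?B \<otimes> s j"
    using assms i by (intro commute_word) auto
  have "s i \<otimes> prod [k..<Suc n] = (s (Suc j) \<otimes> ?A) \<otimes> (s j \<otimes> (s (Suc j) \<otimes> ?B))"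
    using c i by (simp add: P m_assoc)
  also have "\<dots> = ?A \<otimes> ((s (Suc j) \<otimes> (s j \<otimes> s (Suc j))) \<otimes> ?B)"
    using c by (simp add: A m_assoc)
  also have "\<dots> = ?A \<otimes> (s j \<otimes> (s (Suc j) \<otimes> (s j \<otimes> ?B)))"
    using c assms i by (simp add: braid[symmetric] m_assoc)
  also have "\<dots> = prod [k..<Suc n] \<otimes> s (i - 1)"
    using c i by (simp add: B P m_assoc)
  finally show ?thesis .
qed

end

text \<open>Rules for absorbing a letter \<open>i\<close> into the cycle word \<open>[k..<Suc n]\<close> from the left: the cycle then
  starts at \<open>push_start i k\<close>, and \<open>push_rest i k\<close> is a word on fewer letters that comes out on the right.\<close>

fun push_start :: "nat \<Rightarrow> nat \<Rightarrow> nat" where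
  "push_start i k = (if Suc i = k then i else if i = k then Suc k else k)"

fun push_rest :: "nat \<Rightarrow> nat \<Rightarrow> nat list" where
  "push_rest i k = (if Suc i = k \<or> i = k then [] else if i < k then [i] else [i - 1])"

text \<open>The letter either prolongs the cycle word, cancels its first letter, commutes with all
  of it, or slides through it by \<open>slide\<close>. In the last two cases the emerging letter is
  smaller than \<open>n\<close>.\<close>

lemma (in coxeter_family) push:
  assumes "i \<in> {1..n}" "k \<in> {1..Suc n}" "n < N"
  shows "s i \<otimes> prod [k..<Suc n] = prod [push_start i k..<Suc n] \<otimes> prod (push_rest i k)"
proof -
  have c: "s i \<in> carrier G" "prod [k..<Suc n] \<in> carrier G" "prod [Suc i..<Suc n] \<in> carrier G"
    using assms by (auto intro!: closed prod_closed)
  consider "Suc i = k" | "i = k" | "Suc i < k" | "k < i" by linarith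
  then show ?thesis
  proof cases
    case 1
    then show ?thesis using assms c by (simp add: upt_conv_Cons)
  next
    case 2
    have "s i \<otimes> prod [k..<Suc n] = (s i \<otimes> s i) \<otimes> prod [Suc i..<Suc n]"
      using 2 assms c by (simp add: upt_conv_Cons m_assoc)
    then show ?thesis using 2 assms c by (simp add: square)
  next
    case 3
    then show ?thesis using assms c by (subst commute_word) auto
  next
    case 4
    have "s (i - 1) \<in> carrier G" using 4 assms by (intro closed) auto
    then show ?thesis using assms c 4 by (subst slide) auto
  qed
qed

section \<open>Words of adjacent transpositions\<close>

definition adjacent_transposition :: "nat \<Rightarrow> nat \<Rightarrow> nat" where
  "adjacent_transposition i = transpose i (Suc i)"

lemma coxeter_family_sym_group: "coxeter_family (sym_group N) adjacent_transposition N"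
proof -
  interpret group "sym_group N" by (rule sym_group_is_group)
  show ?thesis
  proof
    fix i assume "i \<in> {1..<N}"
    then show "adjacent_transposition i \<in> carrier (sym_group N)"
      by (auto simp: sym_group_carrier adjacent_transposition_def intro: permutes_swap_id)
  qed (auto simp: adjacent_transposition_def fun_eq_iff transpose_def)
qed

abbreviation perm_prod :: "nat \<Rightarrow> nat list \<Rightarrow> nat \<Rightarrow> nat" where
  "perm_prod N \<equiv> word_prod (sym_group N) adjacent_transposition"

lemma perm_prod_fixes: "set w \<subseteq> {1..<n} \<Longrightarrow> n < m \<Longrightarrow> perm_prod N w m = m"
  by (induction w) (auto simp: adjacent_transposition_def)

text \<open>The product is composition, so the last letter acts first and carries \<open>m\<close>
  down step by step.\<close>

lemma perm_prod_cycle: "k \<le> m \<Longrightarrow> perm_prod N [k..<m] m = k"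
  by (induction "m - k" arbitrary: k)
    (auto simp: upt_conv_Cons adjacent_transposition_def)

section \<open>Normal forms of words and the word problem\<close>

context coxeter_family
begin

lemma normal_form:
  assumes "set w \<subseteq> {1..<Suc n}" "n < N"
  shows "\<exists>k \<in> {1..Suc n}. \<exists>v. set v \<subseteq> {1..<n} \<and>
           prod w = prod [k..<Suc n] \<otimes> prod v \<and> perm_prod N w = perm_prod N [k..<Suc n] \<circ> perm_prod N v"
  using assms(1)
proof (induction w)
  case Nil
  \<comment> \<open>At \<open>k = Suc n\<close> the cycle word is empty.\<close>
  show ?case by (intro bexI[of _ "Suc n"] exI[of _ "[]"]) auto
next
  case (Cons i w)
  interpret P: coxeter_family "sym_group N" adjacent_transposition N
    by (rule coxeter_family_sym_group)
  obtain k v where kv: "k \<in> {1..Suc n}" "set v \<subseteq> {1..<n}" "prod w = prod [k..<Suc n] \<otimes> prod v"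
    "perm_prod N w = perm_prod N [k..<Suc n] \<circ> perm_prod N v"
    using Cons.IH Cons.prems by (metis insert_subset list.simps(15))
  let ?k = "push_start i k" and ?r = "push_rest i k"
  have i: "i \<in> {1..n}" using Cons.prems by auto
  have k': "?k \<in> {1..Suc n}" and r: "set ?r \<subseteq> {1..<n}"
    using i kv(1) by auto
  have sub: "set v \<subseteq> {1..<N}" "set ?r \<subseteq> {1..<N}" "set [?k..<Suc n] \<subseteq> {1..<N}"
      "set [k..<Suc n] \<subseteq> {1..<N}" "i \<in> {1..<N}"
    using kv(1,2) r k' i assms(2) by (auto simp del: push_start.simps push_rest.simps)
  note c = sub(1-4)[THEN prod_closed] sub(5)[THEN closed]
  have "prod (i # w) = (s i \<otimes> prod [k..<Suc n]) \<otimes> prod v"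
    using c kv(3) by (simp add: m_assoc)
  also have "\<dots> = prod [?k..<Suc n] \<otimes> prod (?r @ v)"
    using c push[OF i kv(1) assms(2)] sub
    by (simp add: m_assoc prod_append del: push_start.simps push_rest.simps)
  finally have 1: "prod (i # w) = prod [?k..<Suc n] \<otimes> prod (?r @ v)" .
  \<comment> \<open>The symmetric group is a \<open>coxeter_family\<close> too, so
    \<open>push\<close> performs the same rewriting there, with the same new start and the same
    remaining word.\<close>
  have "perm_prod N (i # w) = (adjacent_transposition i \<circ> perm_prod N [k..<Suc n]) \<circ> perm_prod N v"
    by (simp only: word_prod_Cons sym_group_mult kv(4) comp_assoc)
  also have "\<dots> = perm_prod N [?k..<Suc n] \<circ> perm_prod N (?r @ v)"
    using P.push[OF i kv(1) assms(2)] P.prod_append[OF sub(2,1)]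
    by (simp add: sym_group_def comp_assoc del: push_start.simps push_rest.simps)
  finally have "perm_prod N (i # w) = perm_prod N [?k..<Suc n] \<circ> perm_prod N (?r @ v)" .
  moreover have "set (?r @ v) \<subseteq> {1..<n}" using r kv(2) by (simp del: push_rest.simps)
  ultimately show ?case using 1 k' by blast
qed

lemma prod_eq_of_perm_prod_eq:
  assumes "set w \<subseteq> {1..<n}" "set v \<subseteq> {1..<n}" "n \<le> N" "perm_prod N w = perm_prod N v"
  shows "prod w = prod v"
  using assms
proof (induction n arbitrary: w v)
  case (Suc n)
  interpret P: coxeter_family "sym_group N" adjacent_transposition N
    by (rule coxeter_family_sym_group)
  have n: "n < N" using Suc.prems by simp
  obtain k w' where w: "k \<in> {1..Suc n}" "set w' \<subseteq> {1..<n}" "prod w = prod [k..<Suc n] \<otimes> prod w'"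
    "perm_prod N w = perm_prod N [k..<Suc n] \<circ> perm_prod N w'"
    using normal_form[OF Suc.prems(1) n] by auto
  obtain l v' where v: "l \<in> {1..Suc n}" "set v' \<subseteq> {1..<n}" "prod v = prod [l..<Suc n] \<otimes> prod v'"
    "perm_prod N v = perm_prod N [l..<Suc n] \<circ> perm_prod N v'"
    using normal_form[OF Suc.prems(2) n] by auto
  \<comment> \<open>The remaining words have letters below \<open>n\<close> and fix
    \<open>Suc n\<close>; the cycle then sends it to its start, so the permutation determines the
    start.\<close>
  have "perm_prod N w (Suc n) = k" "perm_prod N v (Suc n) = l"
    using w v by (simp_all add: perm_prod_fixes[of _ n] perm_prod_cycle)
  then have kl: "k = l" using Suc.prems by simp
  have "set [k..<Suc n] \<subseteq> {1..<N}" using w(1) n by auto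
  then have "inj (perm_prod N [k..<Suc n])"
    using P.prod_closed[of "[k..<Suc n]"] by (auto simp: sym_group_def dest: permutes_inj)
  \<comment> \<open>Being injective, the common cycle cancels on the left.\<close>
  then have "perm_prod N w' = perm_prod N v'"
    using Suc.prems(4) w(4) v(4) kl by (simp add: fun.inj_map_strong inj_def fun_eq_iff)
  then have "prod w' = prod v'" by (intro Suc.IH w(2) v(2) order.strict_implies_order[OF n])
  then show ?case using w(3) v(3) kl by simp
qed simp

end

lemma perm_prod_surj:
  assumes "p permutes {1..n}" "n \<le> N"
  shows "\<exists>w. set w \<subseteq> {1..<n} \<and> perm_prod N w = p"
  using assms
proof (induction n arbitrary: p)
  case 0
  then show ?case by (intro exI[of _ "[]"]) auto
next
  case (Suc n)
  interpret P: coxeter_family "sym_group N" adjacent_transposition N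
    by (rule coxeter_family_sym_group)
  \<comment> \<open>\<open>?u\<close> inverts the cycle that sends \<open>Suc n\<close> to
    \<open>?k\<close>, so \<open>?u \<circ> p\<close> fixes \<open>Suc n\<close> and falls under the
    induction hypothesis.\<close>
  let ?k = "p (Suc n)" and ?u = "perm_prod N (rev [p (Suc n)..<Suc n])"
  have k: "?k \<in> {1..Suc n}" using permutes_in_image[OF Suc.prems(1), of "Suc n"] by simp
  have sub: "set [?k..<Suc n] \<subseteq> {1..<N}" using k Suc.prems(2) by auto
  have inv: "perm_prod N [?k..<Suc n] \<circ> ?u = id" "?u \<circ> perm_prod N [?k..<Suc n] = id"
    using P.prod_rev[OF sub] P.prod_rev[of "rev [?k..<Suc n]"] sub
    by (auto simp: sym_group_def)
  have perm: "\<And>x. x \<notin> {1..Suc n} \<Longrightarrow> ?u x = x"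
  proof -
    fix x assume x: "x \<notin> {1..Suc n}"
    have "\<And>w. set w \<subseteq> {1..<Suc n} \<Longrightarrow> perm_prod N w x = x"
    proof -
      fix w show "set w \<subseteq> {1..<Suc n} \<Longrightarrow> perm_prod N w x = x"
        using x by (induction w)
          (auto simp: adjacent_transposition_def transpose_def)
    qed
    then show "?u x = x" using k by auto
  qed
  have "bij ?u" using inv by (metis o_bij)
  then have "?u permutes {1..Suc n}" using perm by (auto simp: permutes_def bij_iff)
  then have up: "(?u \<circ> p) permutes {1..Suc n}" using Suc.prems permutes_compose by blast
  have fixed: "(?u \<circ> p) (Suc n) = Suc n"
    using inv(2) perm_prod_cycle[of ?k "Suc n" N] k by (metis atLeastAtMost_iff comp_apply id_apply)
  have "(?u \<circ> p) permutes {1..n}"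
    by (rule permutes_superset[OF up]) (use fixed in \<open>auto simp: le_Suc_eq\<close>)
  then obtain w where w: "set w \<subseteq> {1..<n}" "perm_prod N w = ?u \<circ> p"
    using Suc.IH Suc.prems(2) Suc_leD by blast
  have "perm_prod N ([?k..<Suc n] @ w) = perm_prod N [?k..<Suc n] \<circ> (?u \<circ> p)"
  proof -
    have "set w \<subseteq> {1..<N}" using w(1) Suc.prems(2) by auto
    then show ?thesis using P.prod_append[OF sub] w(2) by (simp only: sym_group_mult)
  qed
  also have "\<dots> = p" using inv(1) by (simp add: comp_assoc[symmetric])
  finally show ?case using w(1) k by (intro exI[of _ "[?k..<Suc n] @ w"]) auto
qed

section \<open>The homomorphism determined by a Coxeter family\<close>

context coxeter_family
begin

text \<open>On permutations of \<open>{1..N}\<close> the choice of word is immaterial, by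
  \<open>prod_eq_of_perm_prod_eq\<close>; words exist by \<open>perm_prod_surj\<close>.\<close>

definition coxeter_hom :: "(nat \<Rightarrow> nat) \<Rightarrow> 'a" where
  "coxeter_hom p = prod (SOME w. set w \<subseteq> {1..<N} \<and> perm_prod N w = p)"

lemma coxeter_hom_perm_prod:
  assumes "set w \<subseteq> {1..<N}"
  shows "coxeter_hom (perm_prod N w) = prod w"
proof -
  let ?v = "SOME v. set v \<subseteq> {1..<N} \<and> perm_prod N v = perm_prod N w"
  have "set ?v \<subseteq> {1..<N} \<and> perm_prod N ?v = perm_prod N w"
    by (rule someI[of _ w]) (use assms in simp)
  then show ?thesis
    unfolding coxeter_hom_def using assms prod_eq_of_perm_prod_eq by blast
qed

lemma coxeter_hom_hom: "coxeter_hom \<in> hom (sym_group N) G"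
proof (rule homI)
  interpret P: coxeter_family "sym_group N" adjacent_transposition N
    by (rule coxeter_family_sym_group)
  fix p p'
  assume "p \<in> carrier (sym_group N)" and "p' \<in> carrier (sym_group N)"
  then obtain w w' where w: "set w \<subseteq> {1..<N}" "perm_prod N w = p"
    "set w' \<subseteq> {1..<N}" "perm_prod N w' = p'"
    using perm_prod_surj[OF _ order.refl] unfolding sym_group_carrier by metis
  show "coxeter_hom p \<in> carrier G"
    using coxeter_hom_perm_prod[OF w(1)] w prod_closed by simp
  show "coxeter_hom (p \<otimes>\<^bsub>sym_group N\<^esub> p') = coxeter_hom p \<otimes> coxeter_hom p'"
    using coxeter_hom_perm_prod[of w] coxeter_hom_perm_prod[of w'] coxeter_hom_perm_prod[of "w @ w'"]
      P.prod_append[of w w'] prod_append[of w w'] w by simp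
qed

lemma coxeter_hom_adjacent:
  assumes "i \<in> {1..<N}"
  shows "coxeter_hom (adjacent_transposition i) = s i"
  using coxeter_hom_perm_prod[of "[i]"] assms closed by (simp add: sym_group_def)

end

section \<open>Automorphism groups of objects\<close>

lemma (in category) group_aut_group:
  assumes "Y \<in> Obj C"
  shows "group (aut_group C Y)"
proof (rule groupI)
  fix f g assume "f \<in> carrier (aut_group C Y)" "g \<in> carrier (aut_group C Y)"
  then obtain f' g' where h: "f \<in> Hom C Y Y" "g \<in> Hom C Y Y" "f' \<in> Hom C Y Y" "g' \<in> Hom C Y Y"
    and inv: "f' \<cdot> f = Ident C Y" "f \<cdot> f' = Ident C Y" "g' \<cdot> g = Ident C Y" "g \<cdot> g' = Ident C Y"
    by (auto simp: aut_group_def)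
  have "(g' \<cdot> f') \<cdot> (f \<cdot> g) = g' \<cdot> ((f' \<cdot> f) \<cdot> g)"
    by (simp add: Comp_assoc[OF h(2,1,3)] Comp_assoc[OF Comp_closed[OF h(2,1)] h(3,4)])
  moreover have "(f \<cdot> g) \<cdot> (g' \<cdot> f') = f \<cdot> ((g \<cdot> g') \<cdot> f')"
    by (simp add: Comp_assoc[OF h(3,4,2)] Comp_assoc[OF Comp_closed[OF h(3,4)] h(2,1)])
  ultimately show "f \<otimes>\<^bsub>aut_group C Y\<^esub> g \<in> carrier (aut_group C Y)"
    using h inv Ident_Comp[of _ Y Y] Comp_closed[of _ Y Y _ Y]
    by (auto simp: aut_group_def intro!: bexI[of _ "g' \<cdot> f'"])
next
  fix f assume "f \<in> carrier (aut_group C Y)"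
  then show "\<exists>g \<in> carrier (aut_group C Y). g \<otimes>\<^bsub>aut_group C Y\<^esub> f = \<one>\<^bsub>aut_group C Y\<^esub>"
    by (auto simp: aut_group_def)
qed (use assms Ident_closed Ident_Comp Comp_assoc in \<open>auto simp: aut_group_def\<close>)

section \<open>Strict symmetric monoidal categories\<close>

context strict_symmetric_monoidal_category
begin

text \<open>Membership in Hom-sets is traded for equations on \<open>Dom\<close> and
  \<open>Cod\<close>, which the simplifier can compute; the rules below have their side conditions
  in this form.\<close>

lemma Hom_iff: "f \<in> Hom C X Y \<longleftrightarrow> f \<in> Arr C \<and> Dom C f = X \<and> Cod C f = Y"
  by (simp add: Hom_def)

lemma Dom_Obj [simp]: "f \<in> Arr C \<Longrightarrow> Dom C f \<in> Obj C"
  and Cod_Obj [simp]: "f \<in> Arr C \<Longrightarrow> Cod C f \<in> Obj C"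
  by (fact Dom_closed Cod_closed)+

lemma Ident_typing [simp]:
  assumes "X \<in> Obj C"
  shows "Ident C X \<in> Arr C" "Dom C (Ident C X) = X" "Cod C (Ident C X) = X"
  using Ident_closed[OF assms] by (auto simp: Hom_iff)

lemma Comp_typing [simp]:
  assumes "f \<in> Arr C" "g \<in> Arr C" "Dom C g = Cod C f"
  shows "g \<cdot> f \<in> Arr C" "Dom C (g \<cdot> f) = Dom C f" "Cod C (g \<cdot> f) = Cod C g"
  using Comp_closed[of f _ _ g] assms by (auto simp: Hom_iff)

lemma Tensor_typing [simp]:
  assumes "f \<in> Arr C" "g \<in> Arr C"
  shows "f \<boxtimes> g \<in> Arr C" "Dom C (f \<boxtimes> g) = Dom C f \<boxtimes>\<^sub>o Dom C g" "Cod C (f \<boxtimes> g) = Cod C f \<boxtimes>\<^sub>o Cod C g"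
  using Tensor_closed[of f _ _ g] assms by (auto simp: Hom_iff)

lemma Symm_typing [simp]:
  assumes "X \<in> Obj C" "Y \<in> Obj C"
  shows "Symm C X Y \<in> Arr C" "Dom C (Symm C X Y) = X \<boxtimes>\<^sub>o Y" "Cod C (Symm C X Y) = Y \<boxtimes>\<^sub>o X"
  using Symm_closed[OF assms] by (auto simp: Hom_iff)

lemmas object_simps [simp] =
  Unit_closed TensorO_closed TensorO_assoc TensorO_Unit Unit_TensorO Tensor_Unit Unit_Tensor

lemma Comp_Ident' [simp]: "\<lbrakk>f \<in> Arr C; Dom C f = X\<rbrakk> \<Longrightarrow> f \<cdot> Ident C X = f"
  and Ident_Comp' [simp]: "\<lbrakk>f \<in> Arr C; Cod C f = X\<rbrakk> \<Longrightarrow> Ident C X \<cdot> f = f"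
  using Comp_Ident Ident_Comp by (auto simp: Hom_iff)

lemma assoc:
  "\<lbrakk>f \<in> Arr C; g \<in> Arr C; h \<in> Arr C; Dom C g = Cod C f; Dom C h = Cod C g\<rbrakk>
    \<Longrightarrow> (h \<cdot> g) \<cdot> f = h \<cdot> (g \<cdot> f)"
  by (intro Comp_assoc) (auto simp: Hom_iff)

lemma interchange:
  "\<lbrakk>f \<in> Arr C; f' \<in> Arr C; g \<in> Arr C; g' \<in> Arr C; Dom C f' = Cod C f; Dom C g' = Cod C g\<rbrakk>
    \<Longrightarrow> (f' \<boxtimes> g') \<cdot> (f \<boxtimes> g) = (f' \<cdot> f) \<boxtimes> (g' \<cdot> g)"
  by (intro Tensor_Comp[symmetric]) (auto simp: Hom_iff)

lemma Symm_natural':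
  "\<lbrakk>f \<in> Arr C; g \<in> Arr C; Cod C f = X'; Cod C g = Y'\<rbrakk>
    \<Longrightarrow> Symm C X' Y' \<cdot> (f \<boxtimes> g) = (g \<boxtimes> f) \<cdot> Symm C (Dom C f) (Dom C g)"
  by (intro Symm_natural) (auto simp: Hom_iff)

text \<open>The second hexagon follows from the first by inversion: the left side is inverse to
  \<open>Symm C Z (X \<boxtimes>\<^sub>o Y)\<close>, whose hexagon factors are inverted one by one
  in the opposite order.\<close>

lemma Symm_Tensor_left:
  assumes [simp]: "X \<in> Obj C" "Y \<in> Obj C" "Z \<in> Obj C"
  shows "Symm C (X \<boxtimes>\<^sub>o Y) Z = (Symm C X Z \<boxtimes> Ident C Y) \<cdot> (Ident C X \<boxtimes> Symm C Y Z)"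
proof -
  let ?l = "Symm C (X \<boxtimes>\<^sub>o Y) Z" and ?m = "Symm C Z (X \<boxtimes>\<^sub>o Y)"
  let ?a = "Symm C X Z \<boxtimes> Ident C Y" and ?b = "Ident C X \<boxtimes> Symm C Y Z"
  let ?c = "Ident C X \<boxtimes> Symm C Z Y" and ?d = "Symm C Z X \<boxtimes> Ident C Y"
  have m: "?m = ?c \<cdot> ?d" by (simp add: Symm_hexagon)
  have bc: "?b \<cdot> ?c = Ident C (X \<boxtimes>\<^sub>o Z \<boxtimes>\<^sub>o Y)" and ad: "?a \<cdot> ?d = Ident C (Z \<boxtimes>\<^sub>o X \<boxtimes>\<^sub>o Y)"
    by (simp_all add: interchange Symm_involutive Tensor_Ident)
  have "(?a \<cdot> ?b) \<cdot> ?m = ?a \<cdot> ((?b \<cdot> ?c) \<cdot> ?d)"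
    by (simp add: m assoc)
  also have "\<dots> = Ident C (Z \<boxtimes>\<^sub>o X \<boxtimes>\<^sub>o Y)"
    unfolding bc using ad by simp
  finally have "((?a \<cdot> ?b) \<cdot> ?m) \<cdot> ?l = ?l" by simp
  moreover have "((?a \<cdot> ?b) \<cdot> ?m) \<cdot> ?l = ?a \<cdot> ?b"
    using Symm_involutive[of "X \<boxtimes>\<^sub>o Y" Z] by (simp add: assoc)
  ultimately show ?thesis by simp
qed

text \<open>Naturality of the symmetry between \<open>X\<close> and
  \<open>Y \<boxtimes>\<^sub>o Z\<close> along \<open>Symm C Y Z\<close>, with both sides expanded
  by the hexagon.\<close>

lemma yang_baxter:
  assumes [simp]: "X \<in> Obj C" "Y \<in> Obj C" "Z \<in> Obj C"
  shows "(Symm C Y Z \<boxtimes> Ident C X) \<cdot> ((Ident C Y \<boxtimes> Symm C X Z) \<cdot> (Symm C X Y \<boxtimes> Ident C Z)) =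
    (Ident C Z \<boxtimes> Symm C X Y) \<cdot> ((Symm C X Z \<boxtimes> Ident C Y) \<cdot> (Ident C X \<boxtimes> Symm C Y Z))"
  using Symm_natural'[of "Ident C X" "Symm C Y Z", OF _ _ refl refl]
  by (simp add: Symm_hexagon assoc)

section \<open>Tensor powers and adjacent swaps\<close>

lemma obj_power_closed [simp]: "X \<in> Obj C \<Longrightarrow> obj_power C X n \<in> Obj C"
  by (induction n) auto

lemma obj_power_add:
  "X \<in> Obj C \<Longrightarrow> obj_power C X (m + n) = obj_power C X m \<boxtimes>\<^sub>o obj_power C X n"
  by (induction n) auto

lemma arr_power_Ident: "X \<in> Obj C \<Longrightarrow> arr_power C (Ident C X) n = Ident C (obj_power C X n)"
  by (induction n) (auto simp: Tensor_Ident)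

lemma adjacent_swap_typing:
  assumes "X \<in> Obj C" "i \<in> {1..<N}"
  shows "adjacent_swap C X N i \<in> Hom C (obj_power C X N) (obj_power C X N)"
proof -
  \<comment> \<open>The truncated subtractions are exact since \<open>1 \<le> i < N\<close>.\<close>
  have "Suc (Suc (i - 1)) + (N - i - 1) = N" using assms(2) by auto
  then have "obj_power C X N = obj_power C X (Suc (Suc (i - 1))) \<boxtimes>\<^sub>o obj_power C X (N - i - 1)"
    using obj_power_add[OF assms(1)] by metis
  then show ?thesis
    using assms by (simp add: Hom_iff adjacent_swap_def arr_power_Ident)
qed

lemma adjacent_swap_square:
  assumes "X \<in> Obj C" "i \<in> {1..<N}"
  shows "adjacent_swap C X N i \<cdot> adjacent_swap C X N i = Ident C (obj_power C X N)"
proof -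
  have "Dom C (adjacent_swap C X N i) = obj_power C X N"
    using adjacent_swap_typing[OF assms] by (simp add: Hom_iff)
  then show ?thesis
    using assms by (simp add: adjacent_swap_def arr_power_Ident interchange Symm_involutive Tensor_Ident)
qed

text \<open>Both swaps live on the same block of three factors, between the same identities, where
  the relation is \<open>yang_baxter\<close>.\<close>

lemma adjacent_swap_braid:
  assumes [simp]: "X \<in> Obj C" and "1 \<le> i" "Suc i < N"
  shows "adjacent_swap C X N i \<cdot> (adjacent_swap C X N (Suc i) \<cdot> adjacent_swap C X N i) =
    adjacent_swap C X N (Suc i) \<cdot> (adjacent_swap C X N i \<cdot> adjacent_swap C X N (Suc i))"
proof -
  obtain a b where i: "i = Suc a" and N: "N = Suc (Suc i) + b"
    using assms by (metis Suc_le_D One_nat_def less_eq_Suc_le le_Suc_ex)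
  let ?A = "Ident C (obj_power C X a)" and ?B = "Ident C (obj_power C X b)" and ?I = "Ident C X"
  let ?t = "Symm C X X"
  have 1: "adjacent_swap C X N i = ?A \<boxtimes> ((?t \<boxtimes> ?I) \<boxtimes> ?B)"
    using obj_power_add[of X 1 b]
    by (simp add: adjacent_swap_def arr_power_Ident i N Tensor_assoc Tensor_Ident)
  have 2: "adjacent_swap C X N (Suc i) = ?A \<boxtimes> ((?I \<boxtimes> ?t) \<boxtimes> ?B)"
    by (simp add: adjacent_swap_def arr_power_Ident i N Tensor_assoc Tensor_Ident[symmetric])
  show ?thesis
    unfolding 1 2 using yang_baxter[of X X X] by (simp add: interchange)
qed

lemma adjacent_swap_commute:
  assumes [simp]: "X \<in> Obj C" and "1 \<le> i" "Suc i < j" "j < N"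
  shows "adjacent_swap C X N i \<cdot> adjacent_swap C X N j = adjacent_swap C X N j \<cdot> adjacent_swap C X N i"
proof -
  \<comment> \<open>The numbers of factors before, between and after the two swapped pairs. The
    pairs are disjoint, so the interchange law suffices.\<close>
  define a m b where "a = i - 1" and "m = j - i - 2" and "b = N - j - 1"
  have i: "i = Suc a" and j: "j = Suc (a + (2 + m))" and N: "N = Suc (j + b)"
    using assms by (auto simp: a_def m_def b_def)
  let ?A = "Ident C (obj_power C X a)" and ?B = "Ident C (obj_power C X b)"
    and ?M = "Ident C (obj_power C X m)" and ?I = "Ident C (obj_power C X 2)" and ?t = "Symm C X X"
  have 2: "obj_power C X 2 = X \<boxtimes>\<^sub>o X" by (simp add: numeral_2_eq_2)
  have 3: "N - i - 1 = m + (2 + b)" "j - 1 = a + (2 + m)" "N - j - 1 = b" by (simp_all add: i j N)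
  have 1: "adjacent_swap C X N i = ?A \<boxtimes> (?t \<boxtimes> (?M \<boxtimes> (?I \<boxtimes> ?B)))"
    unfolding adjacent_swap_def 3 arr_power_Ident[OF assms(1)] obj_power_add[OF assms(1)]
    by (simp add: i Tensor_Ident)
  have 4: "adjacent_swap C X N j = ?A \<boxtimes> (?I \<boxtimes> (?M \<boxtimes> (?t \<boxtimes> ?B)))"
    unfolding adjacent_swap_def 3 arr_power_Ident[OF assms(1)] obj_power_add[OF assms(1)]
    by (simp add: Tensor_assoc Tensor_Ident[symmetric])
  show ?thesis
    unfolding 1 4 by (simp add: interchange 2)
qed

lemma coxeter_family_adjacent_swap:
  assumes "X \<in> Obj C"
  shows "coxeter_family (aut_group C (obj_power C X N)) (adjacent_swap C X N) N"
proof -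
  interpret group "aut_group C (obj_power C X N)"
    by (rule group_aut_group) (simp add: assms)
  show ?thesis
  proof
    fix i assume "i \<in> {1..<N}"
    from adjacent_swap_typing[OF assms this] adjacent_swap_square[OF assms this]
    show "adjacent_swap C X N i \<in> carrier (aut_group C (obj_power C X N))"
      by (auto simp: aut_group_def)
  next
    fix i j assume "1 \<le> i" "Suc i < j" "j < N"
    from adjacent_swap_commute[OF assms this]
    show "adjacent_swap C X N i \<otimes>\<^bsub>aut_group C (obj_power C X N)\<^esub> adjacent_swap C X N j =
        adjacent_swap C X N j \<otimes>\<^bsub>aut_group C (obj_power C X N)\<^esub> adjacent_swap C X N i"
      by (simp add: aut_group_def)
  qed (use assms in \<open>simp_all add: aut_group_def adjacent_swap_square adjacent_swap_braid\<close>)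
qed

text \<open>Evaluates the \<open>THE\<close> in \<open>perm_arr\<close>: \<open>coxeter_hom\<close>
  provides an action, and any action is multiplicative with prescribed values on the letters of
  \<open>w\<close>, so its value at this permutation is forced.\<close>

lemma perm_arr_perm_prod:
  assumes X: "X \<in> Obj C" and w: "set w \<subseteq> {1..<N}"
  shows "perm_arr C X N (perm_prod N w) =
    word_prod (aut_group C (obj_power C X N)) (adjacent_swap C X N) w"
proof -
  interpret coxeter_family "aut_group C (obj_power C X N)" "adjacent_swap C X N" N
    by (rule coxeter_family_adjacent_swap[OF X])
  interpret P: coxeter_family "sym_group N" adjacent_transposition N
    by (rule coxeter_family_sym_group)
  show ?thesis
    unfolding perm_arr_def
  proof (rule the_equality)
    have "symmetric_action C X N coxeter_hom"
      using coxeter_hom_hom coxeter_hom_adjacent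
      by (simp add: symmetric_action_def adjacent_transposition_def)
    then show "\<exists>\<rho>. symmetric_action C X N \<rho> \<and> prod w = \<rho> (perm_prod N w)"
      using coxeter_hom_perm_prod[OF w] by metis
  next
    fix f assume "\<exists>\<rho>. symmetric_action C X N \<rho> \<and> f = \<rho> (perm_prod N w)"
    then obtain \<rho> where \<rho>: "\<rho> \<in> hom (sym_group N) (aut_group C (obj_power C X N))"
      "\<And>i. i \<in> {1..<N} \<Longrightarrow> \<rho> (adjacent_transposition i) = adjacent_swap C X N i"
      "f = \<rho> (perm_prod N w)"
      by (auto simp: symmetric_action_def adjacent_transposition_def)
    have "f = word_prod (aut_group C (obj_power C X N)) (\<lambda>i. \<rho> (adjacent_transposition i)) w"
      unfolding \<rho>(3)
      by (intro hom_word_prod[OF \<rho>(1)] sym_group_is_group group_aut_group P.closed)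
        (use w X in auto)
    also have "\<dots> = prod w"
      using w \<rho>(2) by (intro word_prod_cong) auto
    finally show "f = prod w" .
  qed
qed

end

section \<open>Words for the transposition of an array\<close>

lemma array_transpose_2: "array_transpose 2 = perm_prod 4 [2]"
proof
  fix k :: nat
  consider "k = 0" | "k = 1" | "k = 2" | "k = 3" | "k = 4" | "k > 4" by linarith
  then show "array_transpose 2 k = perm_prod 4 [2] k"
    by cases (simp_all add: array_transpose_def adjacent_transposition_def transpose_def)
qed

text \<open>The word is chosen to match the factorization in \<open>sigma_3\<close>:
  \<open>2, 4, 3\<close> interleaves the first two rows, and \<open>3, 4, 6, 7, 5, 6\<close> inserts
  the third.\<close>

lemma array_transpose_3: "array_transpose 3 = perm_prod 9 [3, 4, 6, 7, 5, 6, 2, 4, 3]"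
proof
  fix k :: nat
  show "array_transpose 3 k = perm_prod 9 [3, 4, 6, 7, 5, 6, 2, 4, 3] k"
  \<comment> \<open>The arguments up to 9 are checked one by one, including 0, which lies outside
    the array; larger ones are fixed by both sides.\<close>
  proof (cases "k < 10")
    case True
    then have "k \<in> set [0..<10]" by simp
    then have "k \<in> {0, 1, 2, 3, 4, 5, 6, 7, 8, 9}" by (simp add: upt_conv_Cons numeral_eq_Suc del: set_upt)
    then show ?thesis
      by (elim insertE emptyE)
        (simp_all add: array_transpose_def adjacent_transposition_def transpose_def)
  next
    case False
    then show ?thesis by (simp add: array_transpose_def adjacent_transposition_def transpose_def)
  qed
qed

section \<open>Rewriting rules and shuffles of tensor factors\<close>

context strict_symmetric_monoidal_category
begin

lemma Ident_whisker_left: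
  "\<lbrakk>A \<in> Obj C; f \<in> Arr C; g \<in> Arr C; Dom C g = Cod C f\<rbrakk>
    \<Longrightarrow> Ident C A \<boxtimes> (g \<cdot> f) = (Ident C A \<boxtimes> g) \<cdot> (Ident C A \<boxtimes> f)"
  by (simp add: interchange)

lemma Ident_whisker_right:
  "\<lbrakk>A \<in> Obj C; f \<in> Arr C; g \<in> Arr C; Dom C g = Cod C f\<rbrakk>
    \<Longrightarrow> (g \<cdot> f) \<boxtimes> Ident C A = (g \<boxtimes> Ident C A) \<cdot> (f \<boxtimes> Ident C A)"
  by (simp add: interchange)

lemmas whisker = Ident_whisker_left Ident_whisker_right

text \<open>The interchange law for right-nested tensors when \<open>f\<close> takes two factors as
  input, which have to be regrouped first.\<close>

lemma interchange_merge_left: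
  assumes "a \<in> Arr C" "b \<in> Arr C" "h \<in> Arr C" "f \<in> Arr C" "g \<in> Arr C"
    and "Dom C f = Cod C a \<boxtimes>\<^sub>o Cod C b" "Dom C g = Cod C h"
  shows "(f \<boxtimes> g) \<cdot> (a \<boxtimes> (b \<boxtimes> h)) = (f \<cdot> (a \<boxtimes> b)) \<boxtimes> (g \<cdot> h)"
  using interchange[of "a \<boxtimes> b" f h g] assms by (simp add: Tensor_assoc)

lemma interchange_merge_right:
  assumes "a \<in> Arr C" "b \<in> Arr C" "h \<in> Arr C" "f \<in> Arr C" "g \<in> Arr C"
    and "Cod C f = Dom C a \<boxtimes>\<^sub>o Dom C b" "Cod C g = Dom C h"
  shows "(a \<boxtimes> (b \<boxtimes> h)) \<cdot> (f \<boxtimes> g) = ((a \<boxtimes> b) \<cdot> f) \<boxtimes> (h \<cdot> g)"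
  using interchange[of f "a \<boxtimes> b" g h] assms by (simp add: Tensor_assoc)

lemma Comp_Ident_pair:
  "\<lbrakk>A \<in> Obj C; B \<in> Obj C; f \<in> Arr C; Dom C f = A \<boxtimes>\<^sub>o B\<rbrakk> \<Longrightarrow> f \<cdot> (Ident C A \<boxtimes> Ident C B) = f"
  "\<lbrakk>A \<in> Obj C; B \<in> Obj C; f \<in> Arr C; Cod C f = A \<boxtimes>\<^sub>o B\<rbrakk> \<Longrightarrow> (Ident C A \<boxtimes> Ident C B) \<cdot> f = f"
  by (simp_all add: Tensor_Ident)

lemmas merge = interchange interchange_merge_left interchange_merge_right Comp_Ident_pair

text \<open>A normal form: tensors nested to the right and identities split factor by factor,
  against the direction of \<open>Tensor_Ident\<close>.\<close>

lemmas flatten = Tensor_assoc Tensor_Ident[symmetric]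

text \<open>Naturality of the symmetry in its first argument, with bystanders \<open>g\<close> on
  the left and \<open>h\<close> on the right.\<close>

lemma slide_Symm:
  assumes "f \<in> Arr C" "g \<in> Arr C" "h \<in> Arr C" "B \<in> Obj C"
  shows "(Ident C (Cod C g) \<boxtimes> (Symm C (Cod C f) B \<boxtimes> Ident C (Cod C h))) \<cdot>
      (g \<boxtimes> ((f \<boxtimes> Ident C B) \<boxtimes> h)) =
    (g \<boxtimes> ((Ident C B \<boxtimes> f) \<boxtimes> h)) \<cdot>
      (Ident C (Dom C g) \<boxtimes> (Symm C (Dom C f) B \<boxtimes> Ident C (Dom C h)))"
  using assms Symm_natural'[of f "Ident C B" "Cod C f" B] by (simp add: interchange)

text \<open>The permutation \<open>A A A B B B\<close> to \<open>A B A B A B\<close> of tensor factors.\<close>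

definition shuffle :: "'o \<Rightarrow> 'o \<Rightarrow> 'a" where
  "shuffle A B =
     (Ident C A \<boxtimes> (Symm C A B \<boxtimes> Ident C (B \<boxtimes>\<^sub>o (A \<boxtimes>\<^sub>o B)))) \<cdot>
     ((Ident C (A \<boxtimes>\<^sub>o (A \<boxtimes>\<^sub>o B)) \<boxtimes> (Symm C A B \<boxtimes> Ident C B)) \<cdot>
      (Ident C (A \<boxtimes>\<^sub>o A) \<boxtimes> (Symm C A B \<boxtimes> Ident C (B \<boxtimes>\<^sub>o B))))"

lemma shuffle_typing [simp]:
  assumes [simp]: "A \<in> Obj C" "B \<in> Obj C"
  shows "shuffle A B \<in> Arr C"
    "Dom C (shuffle A B) = A \<boxtimes>\<^sub>o (A \<boxtimes>\<^sub>o (A \<boxtimes>\<^sub>o (B \<boxtimes>\<^sub>o (B \<boxtimes>\<^sub>o B))))"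
    "Cod C (shuffle A B) = A \<boxtimes>\<^sub>o (B \<boxtimes>\<^sub>o (A \<boxtimes>\<^sub>o (B \<boxtimes>\<^sub>o (A \<boxtimes>\<^sub>o B))))"
  by (simp_all add: shuffle_def)

lemma shuffle_natural:
  assumes [simp]: "f \<in> Arr C" "Dom C f = A" "Cod C f = A'" "B \<in> Obj C"
  shows "shuffle A' B \<cdot> ((f \<boxtimes> (f \<boxtimes> f)) \<boxtimes> Ident C (B \<boxtimes>\<^sub>o (B \<boxtimes>\<^sub>o B))) =
    (f \<boxtimes> (Ident C B \<boxtimes> (f \<boxtimes> (Ident C B \<boxtimes> (f \<boxtimes> Ident C B))))) \<cdot> shuffle A B"
proof -
  have [simp]: "A \<in> Obj C" "A' \<in> Obj C" using Dom_Obj[of f] Cod_Obj[of f] by simp_all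
  let ?J = "Ident C B"
  \<comment> \<open>The three swaps in order of application, as functions of the first object
    because they occur at both \<open>A\<close> and \<open>A'\<close>.\<close>
  define s1 s2 s3 where "s1 = (\<lambda>A. Ident C (A \<boxtimes>\<^sub>o A) \<boxtimes> (Symm C A B \<boxtimes> Ident C (B \<boxtimes>\<^sub>o B)))"
    and "s2 = (\<lambda>A. Ident C (A \<boxtimes>\<^sub>o (A \<boxtimes>\<^sub>o B)) \<boxtimes> (Symm C A B \<boxtimes> Ident C B))"
    and "s3 = (\<lambda>A. Ident C A \<boxtimes> (Symm C A B \<boxtimes> Ident C (B \<boxtimes>\<^sub>o (A \<boxtimes>\<^sub>o B))))"
  have [simp]: "s1 A \<in> Arr C" "Dom C (s1 A) = A \<boxtimes>\<^sub>o (A \<boxtimes>\<^sub>o (A \<boxtimes>\<^sub>o (B \<boxtimes>\<^sub>o (B \<boxtimes>\<^sub>o B))))"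
    "Cod C (s1 A) = A \<boxtimes>\<^sub>o (A \<boxtimes>\<^sub>o (B \<boxtimes>\<^sub>o (A \<boxtimes>\<^sub>o (B \<boxtimes>\<^sub>o B))))"
    "s2 A \<in> Arr C" "Dom C (s2 A) = A \<boxtimes>\<^sub>o (A \<boxtimes>\<^sub>o (B \<boxtimes>\<^sub>o (A \<boxtimes>\<^sub>o (B \<boxtimes>\<^sub>o B))))"
    "Cod C (s2 A) = A \<boxtimes>\<^sub>o (A \<boxtimes>\<^sub>o (B \<boxtimes>\<^sub>o (B \<boxtimes>\<^sub>o (A \<boxtimes>\<^sub>o B))))"
    "s3 A \<in> Arr C" "Dom C (s3 A) = A \<boxtimes>\<^sub>o (A \<boxtimes>\<^sub>o (B \<boxtimes>\<^sub>o (B \<boxtimes>\<^sub>o (A \<boxtimes>\<^sub>o B))))"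
    "Cod C (s3 A) = A \<boxtimes>\<^sub>o (B \<boxtimes>\<^sub>o (A \<boxtimes>\<^sub>o (B \<boxtimes>\<^sub>o (A \<boxtimes>\<^sub>o B))))"
    if [simp]: "A \<in> Obj C" for A
    by (simp_all add: s1_def s2_def s3_def)
  \<comment> \<open>The positions of the three copies of \<open>f\<close> before and after each
    swap.\<close>
  let ?f0 = "f \<boxtimes> (f \<boxtimes> (f \<boxtimes> (?J \<boxtimes> (?J \<boxtimes> ?J))))" and ?f1 = "f \<boxtimes> (f \<boxtimes> (?J \<boxtimes> (f \<boxtimes> (?J \<boxtimes> ?J))))"
    and ?f2 = "f \<boxtimes> (f \<boxtimes> (?J \<boxtimes> (?J \<boxtimes> (f \<boxtimes> ?J))))" and ?f3 = "f \<boxtimes> (?J \<boxtimes> (f \<boxtimes> (?J \<boxtimes> (f \<boxtimes> ?J))))"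
  have 1: "s1 A' \<cdot> ?f0 = ?f1 \<cdot> s1 A"
    using slide_Symm[of f "f \<boxtimes> f" "?J \<boxtimes> ?J" B] by (simp add: s1_def flatten)
  have 2: "s2 A' \<cdot> ?f1 = ?f2 \<cdot> s2 A"
    using slide_Symm[of f "f \<boxtimes> (f \<boxtimes> ?J)" ?J B] by (simp add: s2_def flatten)
  have 3: "s3 A' \<cdot> ?f2 = ?f3 \<cdot> s3 A"
    using slide_Symm[of f f "?J \<boxtimes> (f \<boxtimes> ?J)" B] by (simp add: s3_def flatten)
  have shuffle: "shuffle A B = s3 A \<cdot> (s2 A \<cdot> s1 A)" for A
    by (simp add: shuffle_def s1_def s2_def s3_def)
  have "shuffle A' B \<cdot> ((f \<boxtimes> (f \<boxtimes> f)) \<boxtimes> Ident C (B \<boxtimes>\<^sub>o (B \<boxtimes>\<^sub>o B))) = s3 A' \<cdot> (s2 A' \<cdot> (s1 A' \<cdot> ?f0))"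
    by (simp add: shuffle assoc flatten)
  also have "\<dots> = s3 A' \<cdot> ((s2 A' \<cdot> ?f1) \<cdot> s1 A)"
    by (simp add: 1 assoc)
  also have "\<dots> = (s3 A' \<cdot> ?f2) \<cdot> (s2 A \<cdot> s1 A)"
    by (simp add: 2 assoc)
  also have "\<dots> = ?f3 \<cdot> shuffle A B"
    unfolding 3 by (simp add: shuffle assoc)
  finally show ?thesis .
qed

lemma sigma_2:
  assumes [simp]: "X \<in> Obj C"
  shows "sigma C X 2 = Ident C X \<boxtimes> (Symm C X X \<boxtimes> Ident C X)"
proof -
  have "sigma C X 2 = word_prod (aut_group C (obj_power C X 4)) (adjacent_swap C X 4) [2]"
    using perm_arr_perm_prod[OF assms, of "[2]" 4] by (simp add: sigma_def array_transpose_2)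
  then show ?thesis
    by (simp add: aut_group_def adjacent_swap_def numeral_eq_Suc)
qed

text \<open>Transposing three rows: interleave the first two, then interleave the resulting three
  pairs, each treated as one factor \<open>X \<boxtimes>\<^sub>o X\<close>, with the third
  row.\<close>

lemma sigma_3:
  assumes [simp]: "X \<in> Obj C"
  shows "sigma C X 3 = shuffle (X \<boxtimes>\<^sub>o X) X \<cdot> (shuffle X X \<boxtimes> Ident C (X \<boxtimes>\<^sub>o (X \<boxtimes>\<^sub>o X)))"
proof -
  let ?w = "[3, 4, 6, 7, 5, 6, 2, 4, 3]"
  have 1: "sigma C X 3 = word_prod (aut_group C (obj_power C X 9)) (adjacent_swap C X 9) ?w"
    using perm_arr_perm_prod[OF assms, of ?w 9] by (simp add: sigma_def array_transpose_3)
  show ?thesis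
    \<comment> \<open>Each swap of \<open>X \<boxtimes>\<^sub>o X\<close> with \<open>X\<close>
      splits into two adjacent swaps, so both sides become the same nine swaps in the same
      order.\<close>
    unfolding 1 shuffle_def Symm_Tensor_left[OF assms assms assms]
    by (simp add: aut_group_def adjacent_swap_def numeral_eq_Suc whisker assoc) (simp add: flatten)
qed

end

section \<open>Distributivity of the ternary operation\<close>

text \<open>The binary law is stated with \<open>sigma\<close> already evaluated, as in
  \<open>sigma_2\<close>.\<close>

locale binary_self_distributive = strict_symmetric_monoidal_category C
  for C :: "('o, 'a, 'm) monoidal_category_scheme" (structure) +
  fixes X :: 'o and D q :: 'a
  assumes X_Obj [simp]: "X \<in> Obj C"
    and D_typing [simp]: "D \<in> Arr C" "Dom C D = X" "Cod C D = X \<boxtimes>\<^sub>o X"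
    and q_typing [simp]: "q \<in> Arr C" "Dom C q = X \<boxtimes>\<^sub>o X" "Cod C q = X"
    and distributive: "q \<cdot> (q \<boxtimes> Ident C X) =
      q \<cdot> ((q \<boxtimes> q) \<cdot> ((Ident C X \<boxtimes> (Symm C X X \<boxtimes> Ident C X)) \<cdot> (Ident C X \<boxtimes> (Ident C X \<boxtimes> D))))"
begin

abbreviation J where "J \<equiv> Ident C X"
abbreviation t where "t \<equiv> Symm C X X"
abbreviation J3 where "J3 \<equiv> Ident C (X \<boxtimes>\<^sub>o (X \<boxtimes>\<^sub>o X))"

definition T where "T = q \<cdot> (q \<boxtimes> J)"
definition D3 where "D3 = (D \<boxtimes> J) \<cdot> D"
text \<open>The right actions of \<open>X\<close> on \<open>X \<boxtimes> X\<close> and \<open>X \<boxtimes> X \<boxtimes> X\<close> obtained by comultiplying the acting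
  factor. Self-distributivity says that \<open>q\<close> is equivariant.\<close>

definition act2 where "act2 = (q \<boxtimes> q) \<cdot> ((J \<boxtimes> (t \<boxtimes> J)) \<cdot> (J \<boxtimes> (J \<boxtimes> D)))"
definition act3 where "act3 = (act2 \<boxtimes> q) \<cdot> ((J \<boxtimes> (J \<boxtimes> (t \<boxtimes> J))) \<cdot> (J \<boxtimes> (J \<boxtimes> (J \<boxtimes> D))))"

lemma typing [simp]:
  "T \<in> Arr C" "Dom C T = X \<boxtimes>\<^sub>o (X \<boxtimes>\<^sub>o X)" "Cod C T = X"
  "D3 \<in> Arr C" "Dom C D3 = X" "Cod C D3 = X \<boxtimes>\<^sub>o (X \<boxtimes>\<^sub>o X)"
  "act2 \<in> Arr C" "Dom C act2 = X \<boxtimes>\<^sub>o (X \<boxtimes>\<^sub>o X)" "Cod C act2 = X \<boxtimes>\<^sub>o X"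
  "act3 \<in> Arr C" "Dom C act3 = X \<boxtimes>\<^sub>o (X \<boxtimes>\<^sub>o (X \<boxtimes>\<^sub>o X))" "Cod C act3 = X \<boxtimes>\<^sub>o (X \<boxtimes>\<^sub>o X)"
  by (simp_all add: T_def D3_def act2_def act3_def)

text \<open>Distributivity is used twice: \<open>((xy)z)u\<close> becomes
  \<open>((xy)u')(zu'')\<close>, and then \<open>u'\<close> is comultiplied again and moved into
  \<open>xy\<close>.\<close>

lemma q_T: "q \<cdot> (T \<boxtimes> J) = T \<cdot> act3"
proof -
  let ?R = "(J \<boxtimes> (J \<boxtimes> (t \<boxtimes> J))) \<cdot> (J \<boxtimes> (J \<boxtimes> (J \<boxtimes> D)))"
  have "act2 \<cdot> (q \<boxtimes> (J \<boxtimes> J)) = (q \<boxtimes> q) \<cdot> ((J \<boxtimes> (t \<boxtimes> J)) \<cdot> ((J \<boxtimes> (J \<boxtimes> D)) \<cdot> (q \<boxtimes> (J \<boxtimes> J))))"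
    by (simp add: act2_def assoc)
  also have "(J \<boxtimes> (J \<boxtimes> D)) \<cdot> (q \<boxtimes> (J \<boxtimes> J)) = (q \<boxtimes> (J \<boxtimes> (J \<boxtimes> J))) \<cdot> (J \<boxtimes> (J \<boxtimes> (J \<boxtimes> D)))"
    by (simp add: merge)
  also have "(J \<boxtimes> (t \<boxtimes> J)) \<cdot> \<dots> = ((J \<boxtimes> (t \<boxtimes> J)) \<cdot> (q \<boxtimes> (J \<boxtimes> (J \<boxtimes> J)))) \<cdot> (J \<boxtimes> (J \<boxtimes> (J \<boxtimes> D)))"
    by (simp add: assoc)
  also have "(J \<boxtimes> (t \<boxtimes> J)) \<cdot> (q \<boxtimes> (J \<boxtimes> (J \<boxtimes> J))) = (q \<boxtimes> (J \<boxtimes> (J \<boxtimes> J))) \<cdot> (J \<boxtimes> (J \<boxtimes> (t \<boxtimes> J)))"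
    by (simp add: merge)
  also have "(q \<boxtimes> q) \<cdot> (\<dots> \<cdot> (J \<boxtimes> (J \<boxtimes> (J \<boxtimes> D)))) = ((q \<boxtimes> q) \<cdot> (q \<boxtimes> (J \<boxtimes> (J \<boxtimes> J)))) \<cdot> ?R"
    by (simp add: assoc)
  \<comment> \<open>Here distributivity acts on the inner product \<open>xy\<close>; the outer use
    follows after fact 1.\<close>
  also have "(q \<boxtimes> q) \<cdot> (q \<boxtimes> (J \<boxtimes> (J \<boxtimes> J))) = (q \<cdot> act2) \<boxtimes> q"
    using distributive by (simp add: merge act2_def)
  also have "\<dots> = (q \<boxtimes> J) \<cdot> (act2 \<boxtimes> q)"
    by (simp add: merge)
  finally have 1: "act2 \<cdot> (q \<boxtimes> (J \<boxtimes> J)) = (q \<boxtimes> J) \<cdot> act3"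
    by (simp add: act3_def assoc)
  have "q \<cdot> (T \<boxtimes> J) = (q \<cdot> (q \<boxtimes> J)) \<cdot> (q \<boxtimes> (J \<boxtimes> J))"
    by (simp add: T_def assoc merge)
  also have "\<dots> = q \<cdot> (act2 \<cdot> (q \<boxtimes> (J \<boxtimes> J)))"
    unfolding distributive act2_def[symmetric] by (simp add: assoc)
  also have "\<dots> = T \<cdot> act3"
    unfolding 1 by (simp add: T_def assoc)
  finally show ?thesis .
qed

text \<open>Since \<open>T(w, u, v) = (wu)v\<close>, the factors \<open>u\<close> and
  \<open>v\<close> are moved inside one after the other by \<open>q_T\<close>.\<close>

lemma T_T: "T \<cdot> (T \<boxtimes> (J \<boxtimes> J)) = T \<cdot> (act3 \<cdot> (act3 \<boxtimes> J))"
proof -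
  have "T \<cdot> (T \<boxtimes> (J \<boxtimes> J)) = q \<cdot> ((q \<boxtimes> J) \<cdot> (T \<boxtimes> (J \<boxtimes> J)))"
    by (simp add: T_def assoc)
  also have "(q \<boxtimes> J) \<cdot> (T \<boxtimes> (J \<boxtimes> J)) = (T \<cdot> act3) \<boxtimes> J"
    by (simp add: merge q_T)
  also have "q \<cdot> \<dots> = (q \<cdot> (T \<boxtimes> J)) \<cdot> (act3 \<boxtimes> J)"
    by (simp add: whisker assoc)
  finally show ?thesis
    by (simp add: q_T assoc)
qed

text \<open>Brings \<open>act3\<close> into the order comultiply, permute, multiply, so that the
  permutation can be compared with \<open>sigma\<close>.\<close>

lemma act3_shuffle: "act3 = (q \<boxtimes> (q \<boxtimes> q)) \<cdot> (shuffle X X \<cdot> (J \<boxtimes> (J \<boxtimes> (J \<boxtimes> D3))))"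
proof -
  let ?E = "J \<boxtimes> (t \<boxtimes> (J \<boxtimes> (J \<boxtimes> J)))" and ?F = "J \<boxtimes> (J \<boxtimes> (D \<boxtimes> (J \<boxtimes> J)))"
    and ?t3 = "J \<boxtimes> (J \<boxtimes> (t \<boxtimes> J))" and ?D4 = "J \<boxtimes> (J \<boxtimes> (J \<boxtimes> D))"
    and ?D5 = "J \<boxtimes> (J \<boxtimes> (J \<boxtimes> (D \<boxtimes> J)))"
    and ?t4' = "J \<boxtimes> (J \<boxtimes> (J \<boxtimes> (t \<boxtimes> J)))" and ?t3' = "J \<boxtimes> (J \<boxtimes> (t \<boxtimes> (J \<boxtimes> J)))"
  have "act2 \<boxtimes> q = ((q \<boxtimes> q) \<boxtimes> q) \<cdot> (((J \<boxtimes> (t \<boxtimes> J)) \<boxtimes> Ident C (X \<boxtimes>\<^sub>o X)) \<cdot>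
      ((J \<boxtimes> (J \<boxtimes> D)) \<boxtimes> Ident C (X \<boxtimes>\<^sub>o X)))"
    by (simp add: act2_def interchange)
  then have 1: "act2 \<boxtimes> q = (q \<boxtimes> (q \<boxtimes> q)) \<cdot> (?E \<cdot> ?F)"
    by (simp add: flatten)
  \<comment> \<open>Naturality in the second argument moves the inner comultiplication before the
    swap, which becomes two swaps by the hexagon.\<close>
  have key: "(D \<boxtimes> J) \<cdot> t = (J \<boxtimes> t) \<cdot> ((t \<boxtimes> J) \<cdot> (J \<boxtimes> D))"
    using Symm_natural'[of J D, OF _ _ refl refl] by (simp add: Symm_hexagon assoc)
  have "?F \<cdot> ?t3 = J \<boxtimes> (J \<boxtimes> (((D \<boxtimes> J) \<cdot> t) \<boxtimes> J))"
    by (simp add: merge)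
  also have "\<dots> = ?t4' \<cdot> (?t3' \<cdot> ?D5)"
    unfolding key by (simp add: whisker flatten)
  finally have 2: "?F \<cdot> ?t3 = ?t4' \<cdot> (?t3' \<cdot> ?D5)" .
  have 3: "?D5 \<cdot> ?D4 = J \<boxtimes> (J \<boxtimes> (J \<boxtimes> D3))"
    by (simp add: merge D3_def)
  have "act3 = (q \<boxtimes> (q \<boxtimes> q)) \<cdot> (?E \<cdot> ((?F \<cdot> ?t3) \<cdot> ?D4))"
    by (simp add: act3_def 1 assoc)
  also have "\<dots> = (q \<boxtimes> (q \<boxtimes> q)) \<cdot> ((?E \<cdot> (?t4' \<cdot> ?t3')) \<cdot> (?D5 \<cdot> ?D4))"
    unfolding 2 by (simp add: assoc)
  also have "?E \<cdot> (?t4' \<cdot> ?t3') = shuffle X X"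
    by (simp add: shuffle_def flatten)
  finally show ?thesis unfolding 3 .
qed

lemma ternary_distributive:
  "T \<cdot> (T \<boxtimes> (J \<boxtimes> J)) =
    T \<cdot> ((T \<boxtimes> (T \<boxtimes> T)) \<cdot> (sigma C X 3 \<cdot> ((J \<boxtimes> (J \<boxtimes> J)) \<boxtimes> (D3 \<boxtimes> D3))))"
proof -
  let ?q3 = "q \<boxtimes> (q \<boxtimes> q)" and ?S = "shuffle X X" and ?S' = "shuffle (X \<boxtimes>\<^sub>o X) X"
  let ?W = "J3 \<boxtimes> D3" and ?q6 = "q \<boxtimes> (J \<boxtimes> (q \<boxtimes> (J \<boxtimes> (q \<boxtimes> J))))"
  have W: "J \<boxtimes> (J \<boxtimes> (J \<boxtimes> D3)) = ?W"
    by (simp add: flatten)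
  have act3: "act3 = ?q3 \<cdot> (?S \<cdot> ?W)"
    using act3_shuffle W by simp
  \<comment> \<open>Comultiplying \<open>v\<close> and acting by \<open>u\<close> involve different
    factors, so both comultiplications can be done first.\<close>
  have "?W \<cdot> (act3 \<boxtimes> J) = act3 \<boxtimes> D3"
    by (simp add: interchange)
  also have "\<dots> = (?q3 \<boxtimes> J3) \<cdot> ((?S \<boxtimes> J3) \<cdot> (?W \<boxtimes> D3))"
    unfolding act3 by (simp add: interchange)
  finally have 1: "?W \<cdot> (act3 \<boxtimes> J) = (?q3 \<boxtimes> J3) \<cdot> ((?S \<boxtimes> J3) \<cdot> (?W \<boxtimes> D3))" .
  have "act3 \<cdot> (act3 \<boxtimes> J) = ?q3 \<cdot> (?S \<cdot> (?W \<cdot> (act3 \<boxtimes> J)))"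
    by (subst act3) (simp add: assoc)
  also have "\<dots> = ?q3 \<cdot> ((?S \<cdot> (?q3 \<boxtimes> J3)) \<cdot> ((?S \<boxtimes> J3) \<cdot> (?W \<boxtimes> D3)))"
    unfolding 1 by (simp add: assoc)
  \<comment> \<open>Here \<open>f = q\<close>: moving the first products past the shuffle replaces
    its factor \<open>X\<close> by \<open>X \<boxtimes>\<^sub>o X\<close>.\<close>
  also have "?S \<cdot> (?q3 \<boxtimes> J3) = ?q6 \<cdot> ?S'"
    by (intro shuffle_natural) simp_all
  also have "?q3 \<cdot> ((?q6 \<cdot> ?S') \<cdot> ((?S \<boxtimes> J3) \<cdot> (?W \<boxtimes> D3))) =
      (?q3 \<cdot> ?q6) \<cdot> ((?S' \<cdot> (?S \<boxtimes> J3)) \<cdot> (?W \<boxtimes> D3))"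
    by (simp add: assoc)
  also have "?q3 \<cdot> ?q6 = T \<boxtimes> (T \<boxtimes> T)"
    by (simp add: merge T_def)
  also have "?W \<boxtimes> D3 = (J \<boxtimes> (J \<boxtimes> J)) \<boxtimes> (D3 \<boxtimes> D3)"
    by (simp add: flatten)
  finally show ?thesis
    unfolding T_T by (simp add: sigma_3)
qed

end

section \<open>The functor\<close>

context strict_symmetric_monoidal_category
begin

lemma arr_power_typing [simp]:
  assumes "f \<in> Arr C"
  shows "arr_power C f n \<in> Arr C" "Dom C (arr_power C f n) = obj_power C (Dom C f) n"
    "Cod C (arr_power C f n) = obj_power C (Cod C f) n"
  using assms by (induction n) auto

lemma arr_power_Comp:
  "\<lbrakk>f \<in> Arr C; g \<in> Arr C; Dom C g = Cod C f\<rbrakk>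
    \<Longrightarrow> arr_power C (g \<cdot> f) n = arr_power C g n \<cdot> arr_power C f n"
  by (induction n) (auto simp: interchange)

lemma self_distributive_typing:
  assumes "self_distributive C n (X, W)"
  shows "comonoid C X" "object X \<in> Obj C" "W \<in> Arr C" "Dom C W = obj_power C (object X) n" "Cod C W = object X"
  using assms by (auto simp: self_distributive_def Hom_iff comonoid.object_closed)

lemma self_distributive_2_typing:
  assumes "self_distributive C 2 (X, W)"
  shows "comonoid C X" "object X \<in> Obj C" "W \<in> Arr C" "Dom C W = object X \<boxtimes>\<^sub>o object X" "Cod C W = object X"
  using self_distributive_typing[OF assms] by (simp_all add: numeral_2_eq_2)

text \<open>Composites are again morphisms because tensor powers preserve composition
  (\<open>arr_power_Comp\<close>); the category laws come from \<open>C\<close>.\<close>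

lemma category_SD: "category (SD C n)"
proof
  fix P assume "P \<in> Obj (SD C n)"
  then obtain X W where P: "P = (X, W)" and sd: "self_distributive C n (X, W)"
    by (cases P) (auto simp: SD_def)
  then show "Ident (SD C n) P \<in> Hom (SD C n) P P"
    using self_distributive_typing[OF sd] by (simp add: SD_def Hom_def arr_power_Ident)
next
  fix F G P Q R assume "F \<in> Hom (SD C n) P Q" "G \<in> Hom (SD C n) Q R"
  then obtain X U Y V Z W f g where P: "P = (X, U)" "Q = (Y, V)" "R = (Z, W)"
    and F: "F = (P, f, Q)" "G = (Q, g, R)"
    and sd: "self_distributive C n (X, U)" "self_distributive C n (Y, V)" "self_distributive C n (Z, W)"
    and f [simp]: "f \<in> Arr C" "Dom C f = object X" "Cod C f = object Y"
    and g [simp]: "g \<in> Arr C" "Dom C g = object Y" "Cod C g = object Z"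
    and eq: "f \<cdot> U = V \<cdot> arr_power C f n" "g \<cdot> V = W \<cdot> arr_power C g n"
    by (auto simp: SD_def Hom_def)
  note [simp] = sd[THEN self_distributive_typing(2)] sd[THEN self_distributive_typing(3)]
    sd[THEN self_distributive_typing(4)] sd[THEN self_distributive_typing(5)]
  have "(g \<cdot> f) \<cdot> U = (g \<cdot> V) \<cdot> arr_power C f n"
    by (simp add: assoc eq(1))
  also have "\<dots> = W \<cdot> arr_power C (g \<cdot> f) n"
    unfolding eq(2) by (simp add: assoc arr_power_Comp)
  finally show "Comp (SD C n) G F \<in> Hom (SD C n) P R"
    using sd by (simp add: P F SD_def Hom_def)
qed (auto simp: SD_def Hom_def assoc dest: self_distributive_typing)

lemma ternary_self_distributive:
  assumes "self_distributive C 2 (X, q)"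
  shows "self_distributive C 3 (X, q \<cdot> (q \<boxtimes> Ident C (object X)))"
proof -
  note [simp] = self_distributive_2_typing[OF assms]
  have D [simp]: "comult X \<in> Arr C" "Dom C (comult X) = object X" "Cod C (comult X) = object X \<boxtimes>\<^sub>o object X"
    using comonoid.comult_closed[of C X] by (auto simp: Hom_iff)
  interpret binary_self_distributive C "object X" "comult X" q
  proof
    show "q \<cdot> (q \<boxtimes> Ident C (object X)) = q \<cdot> ((q \<boxtimes> q) \<cdot>
        ((Ident C (object X) \<boxtimes> (Symm C (object X) (object X) \<boxtimes> Ident C (object X))) \<cdot>
         (Ident C (object X) \<boxtimes> (Ident C (object X) \<boxtimes> comult X))))"
      using assms sigma_2[of "object X"]
      by (simp add: self_distributive_def numeral_2_eq_2 Tensor_assoc)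
  qed simp_all
  have "iterated_comult C X 3 = D3"
    by (simp add: numeral_3_eq_3 D3_def)
  then show ?thesis
    using ternary_distributive
    by (simp add: self_distributive_def T_def[symmetric] Hom_iff)
      (simp add: numeral_3_eq_3 numeral_2_eq_2 Tensor_assoc)
qed

text \<open>An arrow that preserves \<open>q\<close> preserves both products nested in
  \<open>T\<close>. Identities and composites are preserved since the underlying arrow is
  unchanged.\<close>

lemma category_functor_ternary:
  "category_functor (SD C 2) (SD C 3) (ternary_obj C) (ternary_arr C)"
proof -
  interpret A: category "SD C 2" by (rule category_SD)
  interpret B: category "SD C 3" by (rule category_SD)
  show ?thesis
  proof
    fix P assume "P \<in> Obj (SD C 2)"
    then show "ternary_obj C P \<in> Obj (SD C 3)"
      by (cases P) (simp add: SD_def ternary_obj_def ternary_self_distributive)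
  next
    fix F P Q assume "F \<in> Hom (SD C 2) P Q"
    then obtain X q Y r f where P: "P = (X, q)" "Q = (Y, r)" and F: "F = (P, f, Q)"
      and sd: "self_distributive C 2 (X, q)" "self_distributive C 2 (Y, r)"
      and f [simp]: "f \<in> Arr C" "Dom C f = object X" "Cod C f = object Y"
      and eq: "f \<cdot> q = r \<cdot> arr_power C f 2"
      by (auto simp: SD_def Hom_def)
    note [simp] = self_distributive_2_typing[OF sd(1)] self_distributive_2_typing[OF sd(2)]
    have fq: "f \<cdot> q = r \<cdot> (f \<boxtimes> f)"
      using eq by (simp add: numeral_2_eq_2)
    have "f \<cdot> (q \<cdot> (q \<boxtimes> Ident C (object X))) = (f \<cdot> q) \<cdot> (q \<boxtimes> Ident C (object X))"
      by (simp add: assoc)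
    also have "\<dots> = r \<cdot> ((f \<cdot> q) \<boxtimes> f)"
      unfolding fq by (simp add: assoc interchange fq)
    also have "\<dots> = (r \<cdot> (r \<boxtimes> Ident C (object Y))) \<cdot> arr_power C f 3"
      by (simp add: fq numeral_3_eq_3 assoc interchange)
    finally show "ternary_arr C F \<in> Hom (SD C 3) (ternary_obj C P) (ternary_obj C Q)"
      using sd by (simp add: P F SD_def Hom_def ternary_arr_def ternary_obj_def ternary_self_distributive)
  qed (auto simp: SD_def Hom_def ternary_arr_def ternary_obj_def)
qed

end

theorem theorem8p6:
  fixes C :: "('o, 'a) monoidal_category"
  assumes "strict_symmetric_monoidal_category C"
  shows "(\<forall>X q. comonoid C X \<longrightarrow>
              q \<in> Hom C (TensorO C (object X) (object X)) (object X) \<longrightarrow>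
              self_distributive C 2 (X, q) \<longrightarrow>
              self_distributive C 3 (X, Comp C q (Tensor C q (Ident C (object X))))) \<and>
         category_functor (BSD C) (TSD C) (ternary_obj C) (ternary_arr C)"
  using strict_symmetric_monoidal_category.ternary_self_distributive[OF assms]
    strict_symmetric_monoidal_category.category_functor_ternary[OF assms] by blast

end
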